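(* For every integer $n\ge 4$, the average number $\mathbb{E}(C^{\mathrm{ct}}_n)$ of comparisons made by the dual-pivot quicksort algorithm ``Count'' on a uniformly random permutation of $n$ distinct elements is $$\mathbb{E}(C^{\mathrm{ct}}_n)=\frac{9}{5}nH_n-\frac{1}{5}nH^{\mathrm{alt}}_n-\frac{89}{25}n+\frac{67}{40}H_n-\frac{3}{40}H^{\mathrm{alt}}_n-\frac{83}{800}+\frac{(-1)^n}{10}-r_n,$$ where $$r_n=\frac{[n\text{ even}]}{320}\Bigl(\frac{1}{n-3}+\frac{3}{n-1}\Bigr)-\frac{[n\text{ odd}]}{320}\Bigl(\frac{3}{n-2}+\frac{1}{n}\Bigr).$$
   Context: Notation: $[\mathit{expr}]$ is $1$ if $\mathit{expr}$ is true and $0$ otherwise; a term multiplied by a bracket equal to $0$ is taken to be $0$. $H_n=\sum_{m=1}^n \frac1m$ and $H^{\mathrm{alt}}_n=\sum_{m=1}^n\frac{(-1)^m}{m}$. Dual-pivot quicksort: the input is a sequence $(a_1,\dots,a_n)$ of $n$ distinct numbers in uniformly random order (w.l.o.g. a uniformly random permutation of $\{1,\dots,n\}$). If $n\le 1$, nothing is done (0 comparisons). If $n\ge2$, one comparison of $a_1$ and $a_n$ determines the pivots $p=\min(a_1,a_n)$ and $q=\max(a_1,a_n)$. Then the remaining $n-2$ elements $a_2,\dots,a_{n-1}$ are classified one after another as small ($<p$), medium (between $p$ and $q$) or large ($>q$). Each element is compared first with one of the two pivots, as prescribed by the classification strategy, and is then compared with the other pivot exactly if its class is not yet determined (so a small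 element costs 1 comparison if compared with $p$ first and 2 if compared with $q$ first; a large element costs 1 if compared with $q$ first and 2 if compared with $p$ first; a medium element always costs 2). Finally the algorithm is applied recursively, with the same strategy, to the group of small, the group of medium and the group of large elements (the inputs of the recursive calls are again in uniformly random order, e.g. if the original relative order is kept). Only comparisons between elements are counted. Strategy ``Count'': let $s_i$, $\ell_i$ be the numbers of elements classified as small, respectively large, among the first $i$ classified elements of the current partitioning step ($s_0=\ell_0=0$). When classifying the $i$th element, $1\le i\le n-2$: if $s_{i-1}\ge \ell_{i-1}$, compare with $p$ first, otherwise compare with $q$ first. $C^{\mathrm{ct}}_n$ is the random variable giving the total number of comparisons (including all recursive calls) when sorting $n$ elements with strategy ``Count''. *)

theory Defs
  imports
    "HOL-Analysis.Harmonic_Numbers"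
    "HOL-Combinatorics.Multiset_Permutations"
    "HOL-Probability.Probability_Mass_Function"
begin

text \<open>
  Number of comparisons made by strategy Count when classifying the elements of a list
  with respect to the pivots \<open>p < q\<close>. The counters \<open>s\<close> and \<open>l\<close> are the numbers of
  elements already classified as small and as large in the current partitioning step.
  An element costs one comparison if its class is determined by the first one (small and
  compared with \<open>p\<close> first, or large and compared with \<open>q\<close> first), and two otherwise.
\<close>

fun count_classify :: "'a::linorder \<Rightarrow> 'a \<Rightarrow> nat \<Rightarrow> nat \<Rightarrow> 'a list \<Rightarrow> nat" where
  "count_classify p q s l [] = 0"
| "count_classify p q s l (x # xs) =
     (if s \<ge> l then (if x < p then 1 else 2) else (if x > q then 1 else 2))
     + count_classify p q (if x < p then s + 1 else s) (if x > q then l + 1 else l) xs"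

text \<open>
  Total number of comparisons of dual-pivot quicksort with strategy Count. The groups
  are passed to the recursive calls in their original relative order.
\<close>

function count_comparisons :: "'a::linorder list \<Rightarrow> nat" where
  "count_comparisons xs =
     (if length xs \<le> 1 then 0
      else
        let p = min (hd xs) (last xs);
            q = max (hd xs) (last xs);
            ys = butlast (tl xs)
        in 1 + count_classify p q 0 0 ys
             + count_comparisons (filter (\<lambda>x. x < p) ys)
             + count_comparisons (filter (\<lambda>x. p < x \<and> x < q) ys)
             + count_comparisons (filter (\<lambda>x. x > q) ys))"
  by pat_completeness auto
termination
  by (relation "Wellfounded.measure length") (auto intro!: le_less_trans[OF length_filter_le])

declare count_comparisons.simps [simp del]

definition alt_harm :: "nat \<Rightarrow> real" where
  "alt_harm n = (\<Sum>m=1..n. (-1) ^ m / real m)"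

definition count_remainder :: "nat \<Rightarrow> real" where
  "count_remainder n =
     of_bool (even n) / 320 * (1 / (real n - 3) + 3 / (real n - 1))
     - of_bool (odd n) / 320 * (3 / (real n - 2) + 1 / real n)"

end

theory Submission
  imports Defs "HOL-Probability.Random_Permutations"
begin

text \<open>
  Filtering a uniformly random permutation gives a uniformly random permutation of the filtered
  set, so the expectation \<open>E n\<close> satisfies \<open>E n = P n + (\<Sum>(E s + E m + E l)) / (n choose 2)\<close> with \<open>P n\<close> the
  expected cost of one partitioning step and the sum over all \<open>s + m + l = n - 2\<close>.
  Averaged over the pivots, the classes of the successive elements form a Polya urn: the counts
  of small, medium and large elements after \<open>i\<close> steps are uniform over the triples with sum \<open>i\<close>,
  and the next element is small with probability \<open>(s + 1) / (i + 3)\<close>. Hence Count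
  guesses the next element with probability \<open>(max s l + 1) / (i + 3)\<close>, whose average over the
  triples is elementary up to a parity term; this is the source of the alternating harmonic
  numbers. The second difference of the recurrence in \<open>n\<close> eliminates the sum, and the closed
  form is verified against the resulting second order recurrence.
\<close>

section \<open>Averages over uniformly random permutations\<close>

abbreviation perm_mean :: "'a set \<Rightarrow> ('a list \<Rightarrow> real) \<Rightarrow> real" where
  "perm_mean A f \<equiv> measure_pmf.expectation (pmf_of_set (permutations_of_set A)) f"

lemma perm_mean_eq_sum:
  "finite A \<Longrightarrow> perm_mean A f = (\<Sum>xs\<in>permutations_of_set A. f xs) / fact (card A)"
  by (subst integral_pmf_of_set) auto

lemma perm_mean_const: "perm_mean A (\<lambda>_. c) = c"
  by simp

lemma perm_mean_add:
  assumes "finite A"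
  shows "perm_mean A (\<lambda>xs. f xs + g xs) = perm_mean A f + perm_mean A g"
  using assms by (simp add: perm_mean_eq_sum sum.distrib add_divide_distrib)

lemma perm_mean_cong:
  assumes "finite A" "\<And>xs. xs \<in> permutations_of_set A \<Longrightarrow> f xs = g xs"
  shows "perm_mean A f = perm_mean A g"
  using assms by (simp add: perm_mean_eq_sum)

lemma perm_mean_Cons:
  assumes "finite A" "A \<noteq> {}"
  shows "perm_mean A f = (\<Sum>x\<in>A. perm_mean (A - {x}) (\<lambda>xs. f (x # xs))) / real (card A)"
proof -
  obtain k where k: "card A = Suc k"
    using assms by (metis card_gt_0_iff gr0_conv_Suc)
  have "sum f (permutations_of_set A) =
          (\<Sum>x\<in>A. \<Sum>xs\<in>(#) x ` permutations_of_set (A - {x}). f xs)"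
    using assms by (subst permutations_of_set_nonempty) (auto intro!: sum.UNION_disjoint)
  also have "\<dots> = (\<Sum>x\<in>A. \<Sum>xs\<in>permutations_of_set (A - {x}). f (x # xs))"
    by (simp add: sum.reindex)
  also have "\<dots> = (\<Sum>x\<in>A. perm_mean (A - {x}) (\<lambda>xs. f (x # xs)) * fact k)"
    using assms k by (intro sum.cong) (auto simp: perm_mean_eq_sum)
  finally show ?thesis
    using assms k by (simp add: perm_mean_eq_sum[of A] flip: sum_distrib_right)
qed

lemma perm_mean_rev:
  assumes "finite A"
  shows "perm_mean A (\<lambda>xs. f (rev xs)) = perm_mean A f"
proof -
  have "map_pmf rev (pmf_of_set (permutations_of_set A)) = pmf_of_set (permutations_of_set A)"
    using assms by (subst map_pmf_of_set_inj) auto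
  then show ?thesis
    by (metis integral_map_pmf)
qed

text \<open>Reversal preserves the uniform distribution, so splitting off the first element carries
  over to the last. The second pivot and the last classified element are removed in this
  way.\<close>

lemma perm_mean_snoc:
  assumes "finite A" "A \<noteq> {}"
  shows "perm_mean A f = (\<Sum>x\<in>A. perm_mean (A - {x}) (\<lambda>xs. f (xs @ [x]))) / real (card A)"
proof -
  have "perm_mean A f = perm_mean A (\<lambda>xs. f (rev xs))"
    using assms by (simp add: perm_mean_rev)
  also have "\<dots> = (\<Sum>x\<in>A. perm_mean (A - {x}) (\<lambda>xs. f (rev xs @ [x]))) / real (card A)"
    using assms by (subst perm_mean_Cons) auto
  also have "\<dots> = (\<Sum>x\<in>A. perm_mean (A - {x}) (\<lambda>xs. f (xs @ [x]))) / real (card A)"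
    using assms perm_mean_rev[of "A - {x}" "\<lambda>xs. f (xs @ [x])" for x] by simp
  finally show ?thesis .
qed

text \<open>\<open>filter P\<close> is the first component of \<open>partition P\<close>, and
  partitioning a random permutation yields a pair of independent random permutations of the two
  parts; the first projection of this pair is uniform.\<close>

lemma perm_mean_filter:
  assumes "finite A"
  shows "perm_mean A (\<lambda>xs. f (filter P xs)) = perm_mean {x\<in>A. P x} f"
proof -
  have "map_pmf (fst \<circ> partition P) (pmf_of_set (permutations_of_set A)) =
          pmf_of_set (permutations_of_set {x\<in>A. P x})"
    unfolding map_pmf_compose comp_apply partition_random_permutations[OF assms]
    by (rule map_fst_pair_pmf)
  then have "map_pmf (filter P) (pmf_of_set (permutations_of_set A)) =
          pmf_of_set (permutations_of_set {x\<in>A. P x})"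
    by (simp add: comp_def)
  then show ?thesis
    by (metis integral_map_pmf)
qed

section \<open>Sums over triples of class sizes\<close>

definition triples :: "nat \<Rightarrow> (nat \<times> nat \<times> nat) set" where
  "triples N = {(s, m, l). s + m + l = N}"

lemma finite_triples [simp]: "finite (triples N)"
  by (rule finite_subset[of _ "{..N} \<times> {..N} \<times> {..N}"]) (auto simp: triples_def)

lemma sum_triples_swap:
  fixes f :: "nat \<Rightarrow> 'b::comm_monoid_add"
  shows "(\<Sum>(s, m, l)\<in>triples N. f m) = (\<Sum>(s, m, l)\<in>triples N. f s)"
    and "(\<Sum>(s, m, l)\<in>triples N. f l) = (\<Sum>(s, m, l)\<in>triples N. f s)"
  by (rule sum.reindex_bij_witness[where i = "\<lambda>(s, m, l). (m, s, l)" and j = "\<lambda>(s, m, l). (m, s, l)"];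
      auto simp: triples_def)
     (rule sum.reindex_bij_witness[where i = "\<lambda>(s, m, l). (l, m, s)" and j = "\<lambda>(s, m, l). (l, m, s)"];
      auto simp: triples_def)

text \<open>Once \<open>s\<close> is fixed, \<open>m\<close> ranges over
  \<open>0, ..., N - s\<close> and determines \<open>l\<close>, which gives the weight
  \<open>N + 1 - s\<close>.\<close>

lemma sum_triples_fst:
  fixes f :: "nat \<Rightarrow> real"
  shows "(\<Sum>(s, m, l)\<in>triples N. f s) = (\<Sum>k\<le>N. real (N + 1 - k) * f k)"
proof -
  have "(\<Sum>(s, m, l)\<in>triples N. f s) = (\<Sum>(s, m)\<in>Sigma {..N} (\<lambda>s. {..N - s}). f s)"
    by (rule sum.reindex_bij_witness[where i = "\<lambda>(s, m). (s, m, N - s - m)"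
          and j = "\<lambda>(s, m, l). (s, m)"]) (auto simp: triples_def)
  also have "\<dots> = (\<Sum>k\<le>N. real (N + 1 - k) * f k)"
    by (subst sum.Sigma[symmetric]) (auto intro!: sum.cong simp: Suc_diff_le)
  finally show ?thesis .
qed

lemma sum_triples_one: "(\<Sum>_\<in>triples N. 1) = (real N + 1) * (real N + 2) / 2"
proof -
  have "(\<Sum>_\<in>triples N. 1) = (\<Sum>k\<le>N. real (N + 1 - k))"
    using sum_triples_fst[of "\<lambda>_. 1" N] by (simp add: case_prod_unfold)
  also have "\<dots> = (\<Sum>k\<le>N. real (k + 1))"
    by (rule sum.reindex_bij_witness[where i = "\<lambda>k. N - k" and j = "\<lambda>k. N - k"]) auto
  also have "\<dots> = (real N + 1) * (real N + 2) / 2"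
    by (induction N) (auto simp: field_simps)
  finally show ?thesis .
qed

text \<open>The summand vanishes at \<open>s = 0\<close>, and an index shift does the rest. This
  turns the removal of a small element, with weight \<open>s\<close>, into the insertion of one,
  with the urn weight \<open>s + 1\<close>; the next two lemmas do so for the other classes.\<close>

lemma sum_triples_Suc_fst:
  fixes f :: "nat \<times> nat \<times> nat \<Rightarrow> real"
  shows "(\<Sum>(s, m, l)\<in>triples (Suc N). real s * f (s - 1, m, l)) =
         (\<Sum>(s, m, l)\<in>triples N. (real s + 1) * f (s, m, l))"
proof -
  have "(\<Sum>(s, m, l)\<in>triples (Suc N). real s * f (s - 1, m, l)) =
        (\<Sum>(s, m, l)\<in>{(s, m, l) \<in> triples (Suc N). s > 0}. real s * f (s - 1, m, l))"
    by (rule sum.mono_neutral_right) auto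
  also have "\<dots> = (\<Sum>(s, m, l)\<in>triples N. (real s + 1) * f (s, m, l))"
    by (rule sum.reindex_bij_witness[where i = "\<lambda>(s, m, l). (s + 1, m, l)" and j = "\<lambda>(s, m, l). (s - 1, m, l)"])
       (auto simp: triples_def of_nat_diff)
  finally show ?thesis .
qed

lemma sum_triples_Suc_snd:
  fixes f :: "nat \<times> nat \<times> nat \<Rightarrow> real"
  shows "(\<Sum>(s, m, l)\<in>triples (Suc N). real m * f (s, m - 1, l)) =
         (\<Sum>(s, m, l)\<in>triples N. (real m + 1) * f (s, m, l))"
proof -
  have "(\<Sum>(s, m, l)\<in>triples (Suc N). real m * f (s, m - 1, l)) =
        (\<Sum>(s, m, l)\<in>{(s, m, l) \<in> triples (Suc N). m > 0}. real m * f (s, m - 1, l))"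
    by (rule sum.mono_neutral_right) auto
  also have "\<dots> = (\<Sum>(s, m, l)\<in>triples N. (real m + 1) * f (s, m, l))"
    by (rule sum.reindex_bij_witness[where i = "\<lambda>(s, m, l). (s, m + 1, l)" and j = "\<lambda>(s, m, l). (s, m - 1, l)"])
       (auto simp: triples_def of_nat_diff)
  finally show ?thesis .
qed

lemma sum_triples_Suc_thd:
  fixes f :: "nat \<times> nat \<times> nat \<Rightarrow> real"
  shows "(\<Sum>(s, m, l)\<in>triples (Suc N). real l * f (s, m, l - 1)) =
         (\<Sum>(s, m, l)\<in>triples N. (real l + 1) * f (s, m, l))"
proof -
  have "(\<Sum>(s, m, l)\<in>triples (Suc N). real l * f (s, m, l - 1)) =
        (\<Sum>(s, m, l)\<in>{(s, m, l) \<in> triples (Suc N). l > 0}. real l * f (s, m, l - 1))"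
    by (rule sum.mono_neutral_right) auto
  also have "\<dots> = (\<Sum>(s, m, l)\<in>triples N. (real l + 1) * f (s, m, l))"
    by (rule sum.reindex_bij_witness[where i = "\<lambda>(s, m, l). (s, m, l + 1)" and j = "\<lambda>(s, m, l). (s, m, l - 1)"])
       (auto simp: triples_def of_nat_diff)
  finally show ?thesis .
qed

text \<open>The parity term suggests induction in steps of two: in the sum for \<open>t + 2\<close>,
  both end terms equal \<open>t + 2\<close>, and the inner terms are those for \<open>t\<close>,
  each raised by one.\<close>

lemma sum_max_complement:
  "(\<Sum>s\<le>t. real (max s (t - s))) = 3 / 4 * real t ^ 2 + real t + of_bool (odd t) / 4"
proof (induction t rule: nat_induct2)
  case (step t)
  have "(\<Sum>s\<le>t + 2. real (max s (t + 2 - s))) =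
          real (t + 2) + (\<Sum>s\<le>t. real (max (Suc s) (t + 2 - Suc s))) + real (t + 2)"
    by (simp add: sum.atMost_Suc_shift[of _ "Suc t"] del: sum.atMost_Suc)
       simp
  also have "(\<Sum>s\<le>t. real (max (Suc s) (t + 2 - Suc s))) = (\<Sum>s\<le>t. real (max s (t - s)) + 1)"
    by (intro sum.cong) auto
  also have "\<dots> = (\<Sum>s\<le>t. real (max s (t - s))) + real (t + 1)"
    by (simp add: sum.distrib)
  finally show ?case
    by (simp only: step.IH) (simp add: power2_eq_square algebra_simps)
qed auto

text \<open>Triples with \<open>m > 0\<close> correspond to \<open>triples N\<close> by lowering
  \<open>m\<close>, which leaves \<open>max s l\<close> unchanged; the layer \<open>m = 0\<close> is
  evaluated by \<open>sum_max_complement\<close>.\<close>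

lemma sum_triples_max:
  "(\<Sum>(s, m, l)\<in>triples N. real (max s l) + 1) =
     (real N + 1) * (2 * real N + 3) * (real N + 3) / 8 - of_bool (even N) / 8"
proof (induction N)
  case 0
  have "triples 0 = {(0, 0, 0)}" by (auto simp: triples_def)
  then show ?case by simp
next
  case (Suc N)
  let ?f = "\<lambda>(s, m, l). real (max s l) + 1"
  have "triples (Suc N) = (\<lambda>(s, m, l). (s, Suc m, l)) ` triples N \<union>
          (\<lambda>s. (s, 0::nat, Suc N - s)) ` {..Suc N}"
  proof (intro equalityI subsetI)
    fix t assume "t \<in> triples (Suc N)"
    then obtain s m l where t: "t = (s, m, l)" "s + m + l = Suc N"
      by (auto simp: triples_def)
    show "t \<in> (\<lambda>(s, m, l). (s, Suc m, l)) ` triples N \<union> (\<lambda>s. (s, 0::nat, Suc N - s)) ` {..Suc N}"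
    proof (cases m)
      case 0
      then show ?thesis using t by auto
    next
      case (Suc k)
      then have "(s, k, l) \<in> triples N" using t by (auto simp: triples_def)
      then have "(\<lambda>(s, m, l). (s, Suc m, l)) (s, k, l) \<in> (\<lambda>(s, m, l). (s, Suc m, l)) ` triples N"
        by (rule imageI)
      then show ?thesis using t Suc by auto
    qed
  qed (auto simp: triples_def)
  then have "sum ?f (triples (Suc N)) = sum ?f ((\<lambda>(s, m, l). (s, Suc m, l)) ` triples N \<union>
      (\<lambda>s. (s, 0::nat, Suc N - s)) ` {..Suc N})"
    by (rule arg_cong)
  also have "\<dots> = sum ?f ((\<lambda>(s, m, l). (s, Suc m, l)) ` triples N) +
      sum ?f ((\<lambda>s. (s, 0::nat, Suc N - s)) ` {..Suc N})"
    by (rule sum.union_disjoint) auto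
  also have "sum ?f ((\<lambda>(s, m, l). (s, Suc m, l)) ` triples N) = sum ?f (triples N)"
    by (subst sum.reindex) (auto simp: inj_on_def intro!: sum.cong)
  also have "sum ?f ((\<lambda>s. (s, 0::nat, Suc N - s)) ` {..Suc N}) =
      (\<Sum>s\<le>Suc N. real (max s (Suc N - s)) + 1)"
    by (subst sum.reindex) (auto simp: inj_on_def)
  also have "\<dots> = (\<Sum>s\<le>Suc N. real (max s (Suc N - s))) + real (N + 2)"
    by (simp only: sum.distrib) simp
  finally show ?case
    by (simp only: Suc.IH sum_max_complement) (simp add: power2_eq_square field_simps)
qed

section \<open>Classification cost for given pivots\<close>

text \<open>The counters met by the last element depend only on how many small and large elements
  precede it, not on their order. This makes it possible to condition on the last element.\<close>

lemma count_classify_snoc: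
  "count_classify p q s l (xs @ [x]) = count_classify p q s l xs +
     count_classify p q (s + length (filter (\<lambda>y. y < p) xs)) (l + length (filter (\<lambda>y. y > q) xs)) [x]"
  by (induction xs arbitrary: s l) auto

definition class_counts :: "'a::linorder \<Rightarrow> 'a \<Rightarrow> 'a set \<Rightarrow> nat \<times> nat \<times> nat" where
  "class_counts p q B = (card {x\<in>B. x < p}, card {x\<in>B. p < x \<and> x < q}, card {x\<in>B. x > q})"

text \<open>
  The recursion removes the last element of a random word with \<open>s\<close> small, \<open>m\<close> medium and \<open>l\<close> large
  letters; the junk values of \<open>s - 1\<close>, \<open>m - 1\<close>, \<open>l - 1\<close> at \<open>0\<close> are multiplied by \<open>0\<close>.
\<close>

fun classify_mean :: "nat \<Rightarrow> nat \<times> nat \<times> nat \<Rightarrow> real" where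
  "classify_mean 0 _ = 0"
| "classify_mean (Suc N) (s, m, l) =
     (real s * (classify_mean N (s - 1, m, l) + (if s - 1 \<ge> l then 1 else 2))
      + real m * (classify_mean N (s, m - 1, l) + 2)
      + real l * (classify_mean N (s, m, l - 1) + (if s \<ge> l - 1 then 2 else 1))) / real (Suc N)"

lemma class_counts_Diff:
  assumes "finite B" "x \<in> B" "class_counts p q B = (s, m, l)" "p < q"
  shows "x < p \<Longrightarrow> class_counts p q (B - {x}) = (s - 1, m, l)"
    and "p < x \<Longrightarrow> x < q \<Longrightarrow> class_counts p q (B - {x}) = (s, m - 1, l)"
    and "x > q \<Longrightarrow> class_counts p q (B - {x}) = (s, m, l - 1)"
proof -
  have *: "{y\<in>B - {x}. P y} = (if P x then {y\<in>B. P y} - {x} else {y\<in>B. P y})" for P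
    by auto
  show "x < p \<Longrightarrow> class_counts p q (B - {x}) = (s - 1, m, l)"
    and "p < x \<Longrightarrow> x < q \<Longrightarrow> class_counts p q (B - {x}) = (s, m - 1, l)"
    and "x > q \<Longrightarrow> class_counts p q (B - {x}) = (s, m, l - 1)"
    using assms unfolding class_counts_def * by (auto simp: less_not_sym)
qed

text \<open>Condition on the last element \<open>x\<close>: the prefix is a uniformly random
  permutation of \<open>B - {x}\<close>, and the counters that decide the cost of \<open>x\<close>
  depend on that set only. Grouping the \<open>x\<close> by class gives the recursion of
  \<open>classify_mean\<close>.\<close>

lemma perm_mean_count_classify:
  assumes "finite B" "p < q" "p \<notin> B" "q \<notin> B" "card B = N"
  shows "perm_mean B (\<lambda>xs. real (count_classify p q 0 0 xs)) = classify_mean N (class_counts p q B)"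
  using assms
proof (induction N arbitrary: B)
  case 0
  then show ?case by (simp add: pmf_of_set_singleton)
next
  case (Suc N)
  obtain s m l where sml: "class_counts p q B = (s, m, l)"
    by (cases "class_counts p q B")
  then have card: "s = card {x\<in>B. x < p}" "m = card {x\<in>B. p < x \<and> x < q}" "l = card {x\<in>B. x > q}"
    by (auto simp: class_counts_def)
  define c where "c s' l' x = real (count_classify p q s' l' [x])" for s' l' x
  define g where "g x = classify_mean N (class_counts p q (B - {x})) +
      (case class_counts p q (B - {x}) of (s', m', l') \<Rightarrow> c s' l' x)" for x
  have step: "perm_mean (B - {x}) (\<lambda>xs. real (count_classify p q 0 0 (xs @ [x]))) = g x"
    if "x \<in> B" for x
  proof -
    obtain s' m' l' where s': "class_counts p q (B - {x}) = (s', m', l')"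
      by (cases "class_counts p q (B - {x})")
    have "perm_mean (B - {x}) (\<lambda>xs. real (count_classify p q 0 0 (xs @ [x]))) =
            perm_mean (B - {x}) (\<lambda>xs. real (count_classify p q 0 0 xs) + c s' l' x)"
    proof (rule perm_mean_cong)
      fix xs assume xs: "xs \<in> permutations_of_set (B - {x})"
      have len: "length (filter P xs) = card {y\<in>B - {x}. P y}" for P
      proof -
        have "distinct xs" "set xs = B - {x}"
          using xs by (auto dest: permutations_of_setD)
        then show ?thesis
          by (metis distinct_card distinct_filter set_filter)
      qed
      show "real (count_classify p q 0 0 (xs @ [x])) = real (count_classify p q 0 0 xs) + c s' l' x"
        using s' unfolding count_classify_snoc len c_def class_counts_def by simp
    qed (use Suc.prems in simp)
    also have "\<dots> = classify_mean N (class_counts p q (B - {x})) + c s' l' x"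
      using Suc.prems that by (subst perm_mean_add) (auto simp: Suc.IH)
    finally show ?thesis
      by (simp add: g_def s')
  qed
  have "perm_mean B (\<lambda>xs. real (count_classify p q 0 0 xs)) = (\<Sum>x\<in>B. g x) / real (Suc N)"
    using Suc.prems by (subst perm_mean_snoc) (auto simp: step)
  also have "(\<Sum>x\<in>B. g x) = (\<Sum>x\<in>{x\<in>B. x < p}. g x) +
      ((\<Sum>x\<in>{x\<in>B. p < x \<and> x < q}. g x) + (\<Sum>x\<in>{x\<in>B. x > q}. g x))"
  proof -
    have "B = {x\<in>B. x < p} \<union> ({x\<in>B. p < x \<and> x < q} \<union> {x\<in>B. x > q})"
      using Suc.prems by (auto simp: not_less_iff_gr_or_eq)
    then have "(\<Sum>x\<in>B. g x) =
        (\<Sum>x\<in>{x\<in>B. x < p} \<union> ({x\<in>B. p < x \<and> x < q} \<union> {x\<in>B. x > q}). g x)"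
      by (rule arg_cong)
    moreover have "{x\<in>B. x < p} \<inter> ({x\<in>B. p < x \<and> x < q} \<union> {x\<in>B. x > q}) = {}"
      "{x\<in>B. p < x \<and> x < q} \<inter> {x\<in>B. x > q} = {}"
      using Suc.prems(2) by auto
    ultimately show ?thesis
      using Suc.prems(1) by (simp add: sum.union_disjoint)
  qed
  also have "(\<Sum>x\<in>{x\<in>B. x < p}. g x) =
      real s * (classify_mean N (s - 1, m, l) + (if s - 1 \<ge> l then 1 else 2))"
  proof -
    have "g x = classify_mean N (s - 1, m, l) + (if s - 1 \<ge> l then 1 else 2)"
      if "x \<in> {x\<in>B. x < p}" for x
      using that class_counts_Diff(1)[OF Suc.prems(1) _ sml, of x] Suc.prems
      by (auto simp: g_def c_def)
    then show ?thesis by (simp add: card(1))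
  qed
  also have "(\<Sum>x\<in>{x\<in>B. p < x \<and> x < q}. g x) = real m * (classify_mean N (s, m - 1, l) + 2)"
  proof -
    have "g x = classify_mean N (s, m - 1, l) + 2" if "x \<in> {x\<in>B. p < x \<and> x < q}" for x
      using that class_counts_Diff(2)[OF Suc.prems(1) _ sml, of x] Suc.prems
      by (auto simp: g_def c_def)
    then show ?thesis by (simp add: card(2))
  qed
  also have "(\<Sum>x\<in>{x\<in>B. x > q}. g x) =
      real l * (classify_mean N (s, m, l - 1) + (if s \<ge> l - 1 then 2 else 1))"
  proof -
    have "g x = classify_mean N (s, m, l - 1) + (if s \<ge> l - 1 then 2 else 1)"
      if "x \<in> {x\<in>B. x > q}" for x
      using that class_counts_Diff(3)[OF Suc.prems(1) _ sml, of x] Suc.prems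
      by (auto simp: g_def c_def)
    then show ?thesis by (simp add: card(3))
  qed
  finally show ?case
    by (simp add: sml)
qed

section \<open>Averaging the classification cost over the pivots\<close>

text \<open>Summed over all triples, the recursion that removes an element becomes an urn step that
  adds one to a triple of \<open>triples N\<close>.\<close>

lemma sum_classify_mean_Suc:
  "(\<Sum>t\<in>triples (Suc N). classify_mean (Suc N) t) =
     (real N + 3) / (real N + 1) * (\<Sum>t\<in>triples N. classify_mean N t)
     + (real N + 2) * (real N + 3)
     - (\<Sum>(s, m, l)\<in>triples N. real (max s l) + 1) / (real N + 1)"
proof -
  let ?w = "classify_mean N"
  let ?f = "\<lambda>(s, m, l). ?w (s, m, l) + (if s \<ge> l then 1 else 2)"
  let ?g = "\<lambda>(s, m, l). ?w (s, m, l) + 2"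
  let ?h = "\<lambda>(s, m, l). ?w (s, m, l) + (if s \<ge> l then 2 else 1)"
  have "(\<Sum>t\<in>triples (Suc N). classify_mean (Suc N) t) =
      ((\<Sum>(s, m, l)\<in>triples (Suc N). real s * ?f (s - 1, m, l)) +
       (\<Sum>(s, m, l)\<in>triples (Suc N). real m * ?g (s, m - 1, l)) +
       (\<Sum>(s, m, l)\<in>triples (Suc N). real l * ?h (s, m, l - 1))) / real (Suc N)"
    by (simp add: sum.distrib [symmetric] sum_divide_distrib case_prod_unfold)
       (intro sum.cong; force)
  also have "(\<Sum>(s, m, l)\<in>triples (Suc N). real s * ?f (s - 1, m, l)) +
       (\<Sum>(s, m, l)\<in>triples (Suc N). real m * ?g (s, m - 1, l)) +
       (\<Sum>(s, m, l)\<in>triples (Suc N). real l * ?h (s, m, l - 1)) =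
       (\<Sum>(s, m, l)\<in>triples N. (real s + 1) * ?f (s, m, l)) +
       (\<Sum>(s, m, l)\<in>triples N. (real m + 1) * ?g (s, m, l)) +
       (\<Sum>(s, m, l)\<in>triples N. (real l + 1) * ?h (s, m, l))"
    by (simp only: sum_triples_Suc_fst[of ?f] sum_triples_Suc_snd[of ?g] sum_triples_Suc_thd[of ?h])
  \<comment> \<open>The urn weights add up to \<open>N + 3\<close>, and every element is charged 2.
    A correct guess saves 1: it has weight \<open>s + 1\<close> if \<open>s \<ge> l\<close> and
    \<open>l + 1\<close> otherwise, that is, \<open>max s l + 1\<close>.\<close>
  also have "\<dots> = (\<Sum>(s, m, l)\<in>triples N. (real N + 3) * ?w (s, m, l) + 2 * (real N + 3)
      - (real (max s l) + 1))"
    unfolding sum.distrib[symmetric]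
    by (intro sum.cong) (auto simp: triples_def algebra_simps max_def)
  also have "\<dots> = (real N + 3) * (\<Sum>t\<in>triples N. ?w t) + 2 * (real N + 3) * (\<Sum>_\<in>triples N. 1)
      - (\<Sum>(s, m, l)\<in>triples N. real (max s l) + 1)"
    by (simp only: case_prod_unfold sum_subtractf sum.distrib sum_distrib_left mult_1_right prod.collapse)
  finally have "(\<Sum>t\<in>triples (Suc N). classify_mean (Suc N) t) =
      ((real N + 3) * (\<Sum>t\<in>triples N. ?w t) + 2 * (real N + 3) * ((real N + 1) * (real N + 2) / 2)
      - (\<Sum>(s, m, l)\<in>triples N. real (max s l) + 1)) / (real N + 1)"
    by (simp only: sum_triples_one of_nat_Suc add.commute[of 1])
  moreover have "((x + 3) * W + 2 * (x + 3) * ((x + 1) * (x + 2) / 2) - M) / (x + 1) =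
      (x + 3) / (x + 1) * W + (x + 2) * (x + 3) - M / (x + 1)" if "x \<ge> 0" for x W M :: real
  proof -
    have "x + 1 \<noteq> 0" using that by simp
    then show ?thesis by (simp add: divide_simps) (simp add: algebra_simps)
  qed
  ultimately show ?thesis
    by simp
qed

text \<open>
  Expected number of elements that are classified by a single comparison, for \<open>N\<close> elements
  and random pivots.
\<close>

definition classify_saving :: "nat \<Rightarrow> real" where
  "classify_saving N = real N / 2 - (harm (N + 1) - 1) / 4
     - (1 / 4 - 1 / (2 * (real N + 1) * (real N + 2))) / 8
     + (alt_harm N / 2 + alt_harm (N + 1) + alt_harm (N + 2) / 2 + 5 / 4) / 8"

lemma alt_harm_Suc: "alt_harm (Suc n) = alt_harm n + (-1) ^ Suc n / (real n + 1)"
  by (simp add: alt_harm_def add.commute)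

lemma harm_Suc_real: "harm (Suc n) = harm n + 1 / (real n + 1)"
  by (simp add: harm_Suc inverse_eq_divide add.commute)

text \<open>Division by the number of triples makes the recursion telescope: the mean saving grows
  by the average of \<open>(max s l + 1) / (N + 3)\<close>.\<close>

lemma sum_classify_mean:
  "(\<Sum>t\<in>triples N. classify_mean N t) =
     (real N + 1) * (real N + 2) / 2 * (2 * real N - classify_saving N)"
proof (induction N)
  case 0
  have [simp]: "triples 0 = {(0, 0, 0)}" by (auto simp: triples_def)
  show ?case
    by (simp add: classify_saving_def harm_def alt_harm_def numeral_2_eq_2)
next
  case (Suc N)
  \<comment> \<open>The partial fractions of \<open>1 / ((N + 1) * (N + 2) * (N + 3))\<close> have
    coefficients \<open>1 / 2\<close>, \<open>-1\<close>, \<open>1 / 2\<close>. Combined with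
    \<open>of_bool (even N) = (1 + (-1) ^ N) / 2\<close> they yield the increments of
    \<open>alt_harm\<close> at \<open>N\<close>, \<open>N + 1\<close> and \<open>N + 2\<close>; the
    constant \<open>5 / 4\<close> makes the saving 0 at \<open>N = 0\<close>.\<close>
  have "classify_saving (Suc N) = classify_saving N +
      2 * ((real N + 1) * (2 * real N + 3) * (real N + 3) / 8 - of_bool (even N) / 8)
        / ((real N + 1) * (real N + 2) * (real N + 3))"
  proof (cases "even N")
    case True
    then show ?thesis
      by (simp add: classify_saving_def alt_harm_Suc harm_Suc_real numeral_2_eq_2)
         (simp add: divide_simps, simp add: algebra_simps)
  next
    case False
    then show ?thesis
      by (simp add: classify_saving_def alt_harm_Suc harm_Suc_real numeral_2_eq_2)
         (simp add: divide_simps, simp add: algebra_simps)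
  qed
  then have "classify_saving N = classify_saving (Suc N) -
      2 * (\<Sum>(s, m, l)\<in>triples N. real (max s l) + 1) / ((real N + 1) * (real N + 2) * (real N + 3))"
    by (simp add: sum_triples_max)
  then show ?case
    by (simp only: sum_classify_mean_Suc Suc.IH) (simp add: divide_simps, simp add: algebra_simps)
qed

section \<open>Pivot pairs and class sizes\<close>

text \<open>A pair of pivots is determined by its two ranks, and these correspond to the class
  sizes. Hence random pivots make all triples equally likely.\<close>

lemma bij_betw_class_counts:
  fixes A :: "'a::linorder set"
  assumes "finite A" "card A = N + 2"
  shows "bij_betw (\<lambda>(p, q). class_counts p q (A - {p, q})) {(p, q) \<in> A \<times> A. p < q} (triples N)"
proof -
  \<comment> \<open>Ranks are counted from 0, so the pivots for the triple \<open>(s, m, l)\<close>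
    have ranks \<open>s\<close> and \<open>s + m + 1\<close>.\<close>
  define r where "r x = card {y\<in>A. y < x}" for x
  have r_mono: "r x < r y" if "x \<in> A" "x < y" for x y
    unfolding r_def using that assms by (intro psubset_card_mono) auto
  have r_eq_iff: "r x = r y \<longleftrightarrow> x = y" if "x \<in> A" "y \<in> A" for x y
    using that r_mono by (metis less_irrefl linorder_neqE)
  have r_less: "r x < N + 2" if "x \<in> A" for x
    unfolding r_def assms(2)[symmetric] using that assms by (intro psubset_card_mono) auto
  have r_image: "r ` A = {..<N + 2}"
    using r_less r_eq_iff assms
    by (intro card_subset_eq) (auto simp: card_image inj_on_def)
  have counts: "class_counts p q (A - {p, q}) = (r p, r q - r p - 1, N + 1 - r q)"
    if "p \<in> A" "q \<in> A" "p < q" for p q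
  proof -
    have "{y\<in>A. y < q} = {y\<in>A. y < p} \<union> insert p {y\<in>A. p < y \<and> y < q}"
      using that by auto
    then have "r q = card ({y\<in>A. y < p} \<union> insert p {y\<in>A. p < y \<and> y < q})"
      unfolding r_def by (rule arg_cong)
    also have "\<dots> = r p + card (insert p {y\<in>A. p < y \<and> y < q})"
      unfolding r_def using assms by (intro card_Un_disjoint) auto
    finally have "r q = r p + card (insert p {y\<in>A. p < y \<and> y < q})" .
    then have rq: "r q = r p + card {y\<in>A. p < y \<and> y < q} + 1"
      using assms by simp
    have "A = {y\<in>A. y < q} \<union> insert q {y\<in>A. y > q}"
      using that by auto
    then have "card A = card ({y\<in>A. y < q} \<union> insert q {y\<in>A. y > q})"
      by (rule arg_cong)
    also have "\<dots> = r q + card (insert q {y\<in>A. y > q})"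
      unfolding r_def using assms by (intro card_Un_disjoint) auto
    finally have "card A = r q + card (insert q {y\<in>A. y > q})" .
    then have "N + 2 = r q + card {y\<in>A. y > q} + 1"
      using assms by simp
    moreover have "{y\<in>A - {p, q}. y < p} = {y\<in>A. y < p}"
        "{y\<in>A - {p, q}. p < y \<and> y < q} = {y\<in>A. p < y \<and> y < q}"
        "{y\<in>A - {p, q}. y > q} = {y\<in>A. y > q}"
      using that by auto
    ultimately show ?thesis
      using rq by (simp add: class_counts_def r_def)
  qed
  show ?thesis
    unfolding bij_betw_def
  proof
    show "inj_on (\<lambda>(p, q). class_counts p q (A - {p, q})) {(p, q) \<in> A \<times> A. p < q}"
    proof (rule inj_onI, clarify)
      fix p q p' q'
      assume *: "p \<in> A" "q \<in> A" "p < q" "p' \<in> A" "q' \<in> A" "p' < q'"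
        "class_counts p q (A - {p, q}) = class_counts p' q' (A - {p', q'})"
      then have "r p = r p'" "r q - r p - 1 = r q' - r p' - 1"
        by (auto simp: counts)
      moreover have "r p < r q" "r p' < r q'"
        using * r_mono by auto
      ultimately have "r p = r p'" "r q = r q'"
        by linarith+
      then show "p = p' \<and> q = q'"
        using * by (simp add: r_eq_iff)
    qed
    show "(\<lambda>(p, q). class_counts p q (A - {p, q})) ` {(p, q) \<in> A \<times> A. p < q} = triples N"
    proof (intro equalityI subsetI)
      fix t assume "t \<in> triples N"
      then obtain s m l where t: "t = (s, m, l)" "s + m + l = N"
        by (auto simp: triples_def)
      then have "s \<in> r ` A" "s + m + 1 \<in> r ` A"
        by (auto simp: r_image)
      then obtain p q where pq: "p \<in> A" "q \<in> A" "r p = s" "r q = s + m + 1"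
        by auto
      moreover have "p < q"
        using pq r_mono[of q p] by (cases p q rule: linorder_cases) auto
      ultimately show "t \<in> (\<lambda>(p, q). class_counts p q (A - {p, q})) ` {(p, q) \<in> A \<times> A. p < q}"
        using t counts[of p q] by (intro image_eqI[of _ _ "(p, q)"]) auto
    next
      fix t assume "t \<in> (\<lambda>(p, q). class_counts p q (A - {p, q})) ` {(p, q) \<in> A \<times> A. p < q}"
      then obtain p q where pq: "p \<in> A" "q \<in> A" "p < q" "t = class_counts p q (A - {p, q})"
        by auto
      then show "t \<in> triples N"
        using counts[of p q] r_mono[of p q] r_less[of q] by (auto simp: triples_def)
    qed
  qed
qed

text \<open>Each pair of pivots occurs in two orders with the same class sizes, hence the factor
  2.\<close>

lemma sum_pivots:
  fixes A :: "'a::linorder set" and f :: "nat \<times> nat \<times> nat \<Rightarrow> real"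
  assumes "finite A" "card A = N + 2"
  shows "(\<Sum>a\<in>A. \<Sum>b\<in>A - {a}. f (class_counts (min a b) (max a b) (A - {a, b}))) =
         2 * (\<Sum>t\<in>triples N. f t)"
proof -
  let ?g = "\<lambda>(a, b). f (class_counts (min a b) (max a b) (A - {a, b}))"
  let ?L = "{(a, b) \<in> A \<times> A. a < b}" and ?R = "{(a, b) \<in> A \<times> A. b < a}"
  have fin: "finite ?L" "finite ?R"
    using assms by (auto intro: finite_subset[of _ "A \<times> A"])
  have "(\<Sum>a\<in>A. \<Sum>b\<in>A - {a}. f (class_counts (min a b) (max a b) (A - {a, b}))) =
        (\<Sum>x\<in>(SIGMA a:A. A - {a}). ?g x)"
    using assms by (subst sum.Sigma) (auto simp: case_prod_unfold)
  also have "(SIGMA a:A. A - {a}) = ?L \<union> ?R"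
    by auto
  also have "(\<Sum>x\<in>\<dots>. ?g x) = (\<Sum>x\<in>?L. ?g x) + (\<Sum>x\<in>?R. ?g x)"
    using fin by (intro sum.union_disjoint) auto
  also have "(\<Sum>x\<in>?R. ?g x) = (\<Sum>x\<in>?L. ?g x)"
    by (rule sum.reindex_bij_witness[where i = prod.swap and j = prod.swap])
       (auto simp: min.commute max.commute insert_commute)
  also have "(\<Sum>x\<in>?L. ?g x) = (\<Sum>x\<in>?L. f ((\<lambda>(p, q). class_counts p q (A - {p, q})) x))"
    by (intro sum.cong) (auto simp: min_def max_def)
  also have "\<dots> = (\<Sum>t\<in>triples N. f t)"
    by (rule sum.reindex_bij_betw[OF bij_betw_class_counts[OF assms]])
  finally show ?thesis by simp
qed

section \<open>The recurrence for the mean number of comparisons\<close>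

lemma count_comparisons_Cons_snoc:
  "count_comparisons (a # ys @ [b]) = 1 + count_classify (min a b) (max a b) 0 0 ys
     + count_comparisons (filter (\<lambda>x. x < min a b) ys)
     + count_comparisons (filter (\<lambda>x. min a b < x \<and> x < max a b) ys)
     + count_comparisons (filter (\<lambda>x. x > max a b) ys)"
  by (subst count_comparisons.simps) (simp add: Let_def)

text \<open>Given both pivots, the middle part is a random permutation of the other elements, and so
  is each filtered group of its own set; linearity adds the costs. The factor 6 is 2 for the order
  of the pivots times 3 for the classes, whose sums agree by symmetry.\<close>

lemma perm_mean_count_comparisons_rec:
  fixes A :: "'a::linorder set" and E :: "nat \<Rightarrow> real"
  assumes A: "finite A" "card A = N + 2"
  assumes E: "\<And>B :: 'a set. finite B \<Longrightarrow> card B < N + 2 \<Longrightarrow>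
                perm_mean B (\<lambda>xs. real (count_comparisons xs)) = E (card B)"
  shows "perm_mean A (\<lambda>xs. real (count_comparisons xs)) =
           1 + 2 * real N - classify_saving N
           + 6 / ((real N + 1) * (real N + 2)) * (\<Sum>k\<le>N. real (N + 1 - k) * E k)"
proof -
  let ?g = "\<lambda>(s, m, l). 1 + classify_mean N (s, m, l) + E s + E m + E l"
  have inner: "perm_mean (A - {a} - {b}) (\<lambda>ys. real (count_comparisons (a # ys @ [b]))) =
      ?g (class_counts (min a b) (max a b) (A - {a, b}))" if "a \<in> A" "b \<in> A - {a}" for a b
  proof -
    define p q B where "p = min a b" and "q = max a b" and "B = A - {a, b}"
    have B: "A - {a} - {b} = B" "finite B" "card B = N" "p < q" "p \<notin> B" "q \<notin> B"
      using that A by (auto simp: B_def p_def q_def min_def max_def)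
    have sub: "perm_mean {x\<in>B. P x} (\<lambda>xs. real (count_comparisons xs)) = E (card {x\<in>B. P x})" for P
    proof (rule E)
      have "card {x\<in>B. P x} \<le> card B"
        using B by (intro card_mono) auto
      then show "card {x\<in>B. P x} < N + 2"
        using B by simp
    qed (use B in simp)
    have "perm_mean B (\<lambda>ys. real (count_comparisons (a # ys @ [b]))) =
        1 + classify_mean N (class_counts p q B) + E (card {x\<in>B. x < p})
        + E (card {x\<in>B. p < x \<and> x < q}) + E (card {x\<in>B. x > q})"
      unfolding count_comparisons_Cons_snoc p_def[symmetric] q_def[symmetric]
      using B by (simp only: of_nat_add perm_mean_add perm_mean_count_classify[OF B(2,4,5,6,3)] sub perm_mean_const
          perm_mean_filter[of B "\<lambda>xs. real (count_comparisons xs)"])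
    then show ?thesis
      unfolding B(1) p_def[symmetric] q_def[symmetric] B_def[symmetric]
      by (simp add: class_counts_def)
  qed
  have "perm_mean A (\<lambda>xs. real (count_comparisons xs)) =
      (\<Sum>a\<in>A. perm_mean (A - {a}) (\<lambda>xs. real (count_comparisons (a # xs)))) / real (N + 2)"
    using A by (subst perm_mean_Cons) auto
  also have "\<dots> = (\<Sum>a\<in>A. (\<Sum>b\<in>A - {a}. perm_mean (A - {a} - {b})
      (\<lambda>ys. real (count_comparisons (a # ys @ [b])))) / real (N + 1)) / real (N + 2)"
  proof (intro arg_cong2[where f = "(/)"] sum.cong refl)
    fix a assume "a \<in> A"
    then have card: "card (A - {a}) = N + 1"
      using A by simp
    then have "finite (A - {a})" "A - {a} \<noteq> {}"
      using A(1) by (simp, metis card.empty add_is_0 one_neq_zero)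
    with card show "perm_mean (A - {a}) (\<lambda>xs. real (count_comparisons (a # xs))) =
        (\<Sum>b\<in>A - {a}. perm_mean (A - {a} - {b})
          (\<lambda>ys. real (count_comparisons (a # ys @ [b])))) / real (N + 1)"
      by (subst perm_mean_snoc) auto
  qed
  also have "\<dots> = (\<Sum>a\<in>A. \<Sum>b\<in>A - {a}. ?g (class_counts (min a b) (max a b) (A - {a, b})))
      / (real (N + 1) * real (N + 2))"
    using inner by (simp add: sum_divide_distrib[symmetric])
  also have "\<dots> = 2 * (\<Sum>t\<in>triples N. ?g t) / (real (N + 1) * real (N + 2))"
    by (subst sum_pivots[OF A]) simp
  also have "(\<Sum>t\<in>triples N. ?g t) = (\<Sum>_\<in>triples N. 1) + (\<Sum>t\<in>triples N. classify_mean N t)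
      + ((\<Sum>(s, m, l)\<in>triples N. E s) + (\<Sum>(s, m, l)\<in>triples N. E m) + (\<Sum>(s, m, l)\<in>triples N. E l))"
    by (simp only: case_prod_unfold sum.distrib prod.collapse add.assoc)
  also have "\<dots> = (real N + 1) * (real N + 2) / 2
      + (real N + 1) * (real N + 2) / 2 * (2 * real N - classify_saving N)
      + 3 * (\<Sum>k\<le>N. real (N + 1 - k) * E k)"
    by (simp only: sum_triples_one sum_classify_mean sum_triples_swap sum_triples_fst)
  finally have "perm_mean A (\<lambda>xs. real (count_comparisons xs)) =
      2 * ((real N + 1) * (real N + 2) / 2
      + (real N + 1) * (real N + 2) / 2 * (2 * real N - classify_saving N)
      + 3 * (\<Sum>k\<le>N. real (N + 1 - k) * E k)) / ((real N + 1) * (real N + 2))"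
    by (simp only: of_nat_add of_nat_1 of_nat_numeral)
  moreover have "2 * (x * y / 2 + x * y / 2 * c + 3 * S) / (x * y) = 1 + c + 6 / (x * y) * S"
    if "x * y \<noteq> 0" for x y c S :: real
    using that by (simp add: field_simps)
  ultimately show ?thesis
    by simp
qed

section \<open>Verification of the closed form\<close>

text \<open>All harmonic numbers are moved to index \<open>N + 2\<close>, where
  \<open>excess N\<close> evaluates the closed form, so that they can be collected.\<close>

lemma classify_saving_eq:
  "classify_saving N = real N / 2 - (harm (N + 2) - 1 / (real N + 2) - 1) / 4
     - (1 / 4 - 1 / (2 * (real N + 1) * (real N + 2))) / 8
     + (2 * alt_harm (N + 2) - 3 / 2 * (-1) ^ N / (real N + 2)
        + (-1) ^ N / (2 * (real N + 1)) + 5 / 4) / 8"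
  by (simp add: classify_saving_def alt_harm_Suc harm_Suc_real numeral_2_eq_2)
     (simp add: divide_simps, simp add: algebra_simps)

definition mean_closed :: "nat \<Rightarrow> real" where
  "mean_closed n = 9 / 5 * real n * harm n - 1 / 5 * real n * alt_harm n - 89 / 25 * real n
     + 67 / 40 * harm n - 3 / 40 * alt_harm n - 83 / 800 + (-1) ^ n / 10 - count_remainder n"

text \<open>
  The closed form is not valid for \<open>n < 4\<close>.
\<close>

definition mean_comparisons :: "nat \<Rightarrow> real" where
  "mean_comparisons n =
     (if n \<le> 1 then 0 else if n = 2 then 1 else if n = 3 then 8 / 3 else mean_closed n)"

text \<open>
  With the shift \<open>n = N + 2\<close>, this is \<open>2 * (n choose 2)\<close> times the expected cost of the recursive calls.
\<close>

definition excess :: "nat \<Rightarrow> real" where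
  "excess N = (real N + 1) * (real N + 2) * (mean_comparisons (N + 2) - (1 + 2 * real N - classify_saving N))"

text \<open>A fixed parity removes signs and brackets, and \<open>N \<ge> 2\<close> puts
  \<open>N + 2\<close> in the range of the closed form. The prefactor cancels all poles except that
  of the remainder at \<open>N = 1\<close>, where it equals 6; this gives
  \<open>6 / 320 = 3 / 160\<close>.\<close>

lemma excess_even:
  assumes "N \<ge> 2" "even N"
  shows "excess N = (real N + 1) * (real N + 2) * ((9 / 5 * real N + 201 / 40) * harm (N + 2)
      - (real N / 5 + 9 / 40) * alt_harm (N + 2)) - 253 / 50 * real N ^ 3 - 18343 / 800 * real N ^ 2
      - 26603 / 800 * real N - 12223 / 800 - 3 / (160 * (real N - 1))"
proof -
  define x where "x = real N"
  have x: "x \<ge> 2" "x - 1 \<noteq> 0" "x + 1 \<noteq> 0" "x + 2 \<noteq> 0"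
    using assms by (auto simp: x_def)
  have N: "real N = x" "real (N + 2) = x + 2" "x + 2 - 3 = x - 1" "x + 2 - 1 = x + 1"
    by (auto simp: x_def)
  have m: "mean_comparisons (N + 2) = mean_closed (N + 2)"
    using assms by (auto simp: mean_comparisons_def)
  show ?thesis
    unfolding excess_def m classify_saving_eq mean_closed_def count_remainder_def N
    using x assms(2)
    by simp (simp add: divide_simps, simp add: algebra_simps power2_eq_square power3_eq_cube)
qed

text \<open>As in the even case, but the remaining pole is at \<open>N = 0\<close>, where the
  prefactor 2 meets the coefficient \<open>3 / 320\<close>.\<close>

lemma excess_odd:
  assumes "N \<ge> 2" "odd N"
  shows "excess N = (real N + 1) * (real N + 2) * ((9 / 5 * real N + 201 / 40) * harm (N + 2)
      - (real N / 5 + 9 / 40) * alt_harm (N + 2)) - 253 / 50 * real N ^ 3 - 18503 / 800 * real N ^ 2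
      - 26863 / 800 * real N - 12393 / 800 + 3 / (160 * real N)"
proof -
  define x where "x = real N"
  have x: "x \<ge> 2" "x \<noteq> 0" "x + 1 \<noteq> 0" "x + 2 \<noteq> 0"
    using assms by (auto simp: x_def)
  have N: "real N = x" "real (N + 2) = x + 2" "x + 2 - 2 = x"
    by (auto simp: x_def)
  have m: "mean_comparisons (N + 2) = mean_closed (N + 2)"
    using assms by (auto simp: mean_comparisons_def)
  show ?thesis
    unfolding excess_def m classify_saving_eq mean_closed_def count_remainder_def N
    using x assms(2)
    by simp (simp add: divide_simps, simp add: algebra_simps power2_eq_square power3_eq_cube)
qed

text \<open>This is the recurrence with the sum eliminated, checked for the closed form.
  \<open>N\<close> and \<open>N + 2\<close> have one parity and \<open>N + 1\<close> the other, so
  both formulas for \<open>excess\<close> enter in either case.\<close>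

lemma excess_diff2:
  assumes "N \<ge> 2"
  shows "excess (N + 2) - 2 * excess (N + 1) + excess N = 6 * mean_comparisons (N + 2)"
proof -
  define x where "x = real N"
  define h :: real where "h = harm (N + 2)"
  define a where "a = alt_harm (N + 2)"
  \<comment> \<open>These are the increments of the harmonic numbers past \<open>N + 2\<close>. In
    terms of them the claim is a polynomial identity modulo the two relations
    \<open>uv\<close>.\<close>
  define u v where "u = 1 / (x + 3)" and "v = 1 / (x + 4)"
  have N: "real N = x" "real (N + 1) = x + 1" "real (N + 2) = x + 2"
      "x + 2 - 3 = x - 1" "x + 2 - 2 = x" "x + 2 - 1 = x + 1" "x + 1 - 1 = x"
    by (auto simp: x_def)
  have uv: "(x + 3) * u = 1" "(x + 4) * v = 1"
    by (simp_all add: u_def v_def x_def)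
  have h: "harm (N + 2) = h" "harm (N + 3) = h + u" "harm (N + 4) = h + u + v"
    using harm_Suc_real[of "N + 2"] harm_Suc_real[of "N + 3"]
    by (simp_all add: h_def u_def v_def x_def eval_nat_numeral ac_simps)
  have a: "alt_harm (N + 2) = a" "alt_harm (N + 3) = a - (-1) ^ N * u"
     "alt_harm (N + 4) = a - (-1) ^ N * u + (-1) ^ N * v"
    using alt_harm_Suc[of "N + 2"] alt_harm_Suc[of "N + 3"]
    by (simp_all add: a_def u_def v_def x_def eval_nat_numeral ac_simps)
  have n: "N + 1 + 2 = N + 3" "N + 2 + 2 = N + 4"
    by auto
  have m: "mean_comparisons (N + 2) = mean_closed (N + 2)"
    using assms by (auto simp: mean_comparisons_def)
  show ?thesis
  proof (cases "even N")
    case True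
    then have par: "even N" "odd (N + 1)" "even (N + 2)"
      by auto
    have "N + 1 \<ge> 2" "N + 2 \<ge> 2"
      using assms by auto
    note ex = excess_even[OF assms par(1)] excess_odd[OF this(1) par(2)] excess_even[OF this(2) par(3)]
    \<comment> \<open>These stand for the poles on both sides. Their coefficients agree, so they can
      enter the identity as free unknowns.\<close>
    define w z where "w = 1 / (x - 1)" and "z = 1 / (x + 1)"
    have inv: "1 / (x - 1) = w" "3 / (x + 1) = 3 * z" "3 / (160 * (x - 1)) = 3 / 160 * w" "3 / (160 * (x + 1)) = 3 / 160 * z"
      by (simp_all add: w_def z_def)
    have sgn: "(-1) ^ N = (1::real)" "(-1) ^ (N + 2) = (1::real)"
      "of_bool (even (N + 2)) = (1::real)" "of_bool (odd (N + 2)) / 320 * y = 0" for y :: real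
      using par by simp_all
    show ?thesis
      unfolding ex n m mean_closed_def count_remainder_def h a N sgn inv
      using uv by algebra
  next
    case False
    then have par: "odd N" "even (N + 1)" "odd (N + 2)"
      by auto
    have "N + 1 \<ge> 2" "N + 2 \<ge> 2"
      using assms by auto
    note ex = excess_odd[OF assms par(1)] excess_even[OF this(1) par(2)] excess_odd[OF this(2) par(3)]
    define w z where "w = 1 / x" and "z = 1 / (x + 2)"
    have inv: "3 / x = 3 * w" "1 / (x + 2) = z" "3 / (160 * x) = 3 / 160 * w" "3 / (160 * (x + 2)) = 3 / 160 * z"
      by (simp_all add: w_def z_def)
    have sgn: "(-1) ^ N = (- 1::real)" "(-1) ^ (N + 2) = (- 1::real)"
      "of_bool (odd (N + 2)) = (1::real)" "of_bool (even (N + 2)) / 320 * y = 0" for y :: real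
      using par by simp_all
    show ?thesis
      unfolding ex n m mean_closed_def count_remainder_def h a N sgn inv
      using uv by algebra
  qed
qed

lemmas small_values = mean_comparisons_def mean_closed_def classify_saving_def count_remainder_def
  harm_def alt_harm_def excess_def

text \<open>The second order recurrence starts at index 2 and first reaches \<open>N = 4\<close>.
  The cases 2 and 3 supply its initial values; the cases 0 and 1 concern the exceptional lengths 2
  and 3.\<close>

lemma weighted_sum_base:
  assumes "N \<le> 3"
  shows "6 * (\<Sum>k\<le>N. real (N + 1 - k) * mean_comparisons k) = excess N"
proof -
  from assms consider "N = 0" | "N = 1" | "N = 2" | "N = 3" by linarith
  then show ?thesis
    by cases (simp_all add: small_values eval_nat_numeral field_simps, simp_all flip: numeral_2_eq_2)
qed

text \<open>The weights are linear in \<open>N\<close>, so the second difference of the sum is a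
  single term, and \<open>excess_diff2\<close> shows that \<open>excess\<close> obeys the same
  recurrence.\<close>

lemma weighted_sum_mean_comparisons:
  "6 * (\<Sum>k\<le>N. real (N + 1 - k) * mean_comparisons k) = excess N"
proof (induction N rule: less_induct)
  case (less N)
  show ?case
  proof (cases "N \<le> 3")
    case True
    then show ?thesis by (rule weighted_sum_base)
  next
    case False
    define M where "M = N - 2"
    have M: "N = M + 2" "M \<ge> 2"
      using False by (auto simp: M_def)
    let ?S = "\<lambda>N. \<Sum>k\<le>N. real (N + 1 - k) * mean_comparisons k"
    have Suc: "?S (Suc K) = ?S K + (\<Sum>k\<le>Suc K. mean_comparisons k)" for K
    proof -
      \<comment> \<open>The additional term \<open>k = Suc K\<close> has weight
        \<open>K + 1 - k = 0\<close>; now both sums have the same range.\<close>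
      have "?S K = (\<Sum>k\<le>Suc K. real (K + 1 - k) * mean_comparisons k)"
        by simp
      then show ?thesis
        by (simp only: sum.distrib[symmetric]) (intro sum.cong, auto simp: of_nat_diff algebra_simps)
    qed
    have "?S (M + 2) - 2 * ?S (M + 1) + ?S M = mean_comparisons (M + 2)"
      using Suc[of M] Suc[of "Suc M"] by (simp add: numeral_2_eq_2)
    moreover have "6 * ?S M = excess M" "6 * ?S (M + 1) = excess (M + 1)"
      by (rule less.IH; use M(1) in simp)+
    ultimately show ?thesis
      using excess_diff2[OF M(2)] unfolding M(1) by linarith
  qed
qed

section \<open>The mean number of comparisons\<close>

lemma perm_mean_count_comparisons:
  fixes A :: "'a::linorder set"
  assumes "finite A"
  shows "perm_mean A (\<lambda>xs. real (count_comparisons xs)) = mean_comparisons (card A)"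
  using assms
proof (induction "card A" arbitrary: A rule: less_induct)
  case less
  show ?case
  proof (cases "card A \<le> 1")
    case True
    have "perm_mean A (\<lambda>xs. real (count_comparisons xs)) = perm_mean A (\<lambda>_. 0)"
    proof (rule perm_mean_cong[OF less.prems])
      fix xs assume "xs \<in> permutations_of_set A"
      then have "length xs \<le> 1"
        using True by (simp add: length_finite_permutations_of_set)
      then show "real (count_comparisons xs) = 0"
        by (subst count_comparisons.simps) simp
    qed
    then show ?thesis
      using True by (simp add: mean_comparisons_def)
  next
    case False
    define N where "N = card A - 2"
    have card: "card A = N + 2"
      using False by (simp add: N_def)
    have "perm_mean A (\<lambda>xs. real (count_comparisons xs)) =
        1 + 2 * real N - classify_saving N
        + 6 / ((real N + 1) * (real N + 2)) * (\<Sum>k\<le>N. real (N + 1 - k) * mean_comparisons k)"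
      by (rule perm_mean_count_comparisons_rec[OF less.prems card]) (use less.hyps card in simp)
    also have "\<dots> = 1 + 2 * real N - classify_saving N
        + 6 * (\<Sum>k\<le>N. real (N + 1 - k) * mean_comparisons k) / ((real N + 1) * (real N + 2))"
      by simp
    \<comment> \<open>\<open>excess\<close> is the recurrence solved for the sum, so inserting it
      returns the mean at \<open>N + 2\<close>.\<close>
    also have "\<dots> = mean_comparisons (N + 2)"
    proof -
      have "(real N + 1) * (real N + 2) \<noteq> 0"
        by (simp add: add_eq_0_iff)
      then show ?thesis
        unfolding weighted_sum_mean_comparisons excess_def by simp
    qed
    finally show ?thesis
      by (simp add: card)
  qed
qed

theorem theorem10p3:
  fixes n :: nat and A :: "'a::linorder set"
  assumes "n \<ge> 4" and "finite A" and "card A = n"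
  shows "measure_pmf.expectation (pmf_of_set (permutations_of_set A))
           (\<lambda>xs. real (count_comparisons xs))
         = 9 / 5 * real n * harm n - 1 / 5 * real n * alt_harm n - 89 / 25 * real n
           + 67 / 40 * harm n - 3 / 40 * alt_harm n - 83 / 800 + (-1) ^ n / 10
           - count_remainder n"
  using assms perm_mean_count_comparisons[of A]
  by (simp add: mean_comparisons_def mean_closed_def)

end
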